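(* Let $(x^l,\mu^l)$ be a solution to the relaxed master problem (RMP), let $d^l\in\mathcal D$ be such that $x^l\in\mathcal X_{d^l}$, and suppose $x^l\in\mathcal K_{d^l}$. Let $x^v$ be (the $x$-part of) some solution to (RMP), let $d^v$ be such that $x^v\in\mathcal X_{d^v}$, let $s\in\mathcal S_{d^v}$, and let $\rho^v$ be an optimal solution to the dual of $\Psi(x^v,\xi_{sd^v})$. Then $x=x^l$ satisfies the inequality $$(\rho^v)^\top(h_{sd^v}-T_{sd^v}x)\le U_{d^vs}\,(1-\mathbb 1_{d^v}(x)).$$
   Context: Setting: $\mathcal X\subseteq\mathbb R^{n_1}$, $c\in\mathbb R^{n_1}$, $\mathcal D$ is a finite set, $(\mathcal X_d)_{d\in\mathcal D}$ is a partition of $\mathcal X$, and $\mathbb 1_d:\mathcal X\to\{0,1\}$ is the characteristic function of $\mathcal X_d$. For $x\in\mathcal X$, the unique $d$ with $x\in\mathcal X_d$ is the (index of the) distribution enforced by $x$. Discrete distributions: for each $d\in\mathcal D$ the random data has a discrete distribution $\mathsf P_d$ with a finite set of scenarios $\mathcal S_d$; scenario $s\in\mathcal S_d$ has realization $\xi_{sd}=(q_{sd},W_{sd},T_{sd},h_{sd})$, with $q_{sd}\in\mathbb R^{n_2}$, $W_{sd}\in\mathbb R^{m_2\times n_2}$, $T_{sd}\in\mathbb R^{m_2\times n_1}$, $h_{sd}\in\mathbb R^{m_2}$, and probability $\pi_{sd}>0$, $\sum_{s\in\mathcal S_d}\pi_{sd}=1$. The second-stage problem is $Q(x,\xi)=\min_{y\ge0}\{q^\top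 y: Wy=h-Tx\}$. $\mathcal K_{sd}=\{x\in\mathbb R^{n_1}:\exists y\ge 0,\ W_{sd}y=h_{sd}-T_{sd}x\}$, $\mathcal K_d=\bigcap_{s\in\mathcal S_d}\mathcal K_{sd}$, $\mathbf 1=(1,\dots,1)^\top\in\mathbb R^{m_2}$, and $$\Psi(x,\xi_{sd}):=\min_{y\in\mathbb R^{n_2}_+,\;w^+,w^-\in\mathbb R^{m_2}_+}\{\mathbf 1^\top w^++\mathbf 1^\top w^-:\;W_{sd}y+w^+-w^-=h_{sd}-T_{sd}x\},$$ whose dual is $\max\{\rho^\top(h_{sd}-T_{sd}x):\rho^\top W_{sd}\le0,\ -\mathbf 1\le\rho\le\mathbf 1\}$. Assumption: for all $d\in\mathcal D$, $s\in\mathcal S_d$ there is a constant $U_{ds}<\infty$ with $U_{ds}\ge\max_{x\in\mathcal X}\Psi(x,\xi_{sd})$. (RMP): given finite sets $\underline{\mathcal F_d},\underline{\mathcal O_d}$ of real-valued functions on $\mathcal X$ ($d\in\mathcal D$), minimize $c^\top x+\mu$ over $x\in\mathcal X$, $\mu\in\mathbb R$ subject to, for every $d\in\mathcal D$: if $x\in\mathcal X_d$ then $f(x)\le0$ for all $f\in\underline{\mathcal F_d}$ and $o(x)\le\mu$ for all $o\in\underline{\mathcal O_d}$. A "solution" to (RMP) is a feasible point. *)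

theory Defs
  imports "HOL-Analysis.Analysis" "HOL-Library.Disjoint_Sets"
begin

record ('n1::finite, 'n2::finite, 'm2::finite) scenario_data =
  scen_q :: "real ^ 'n2"
  scen_W :: "real ^ 'n2 ^ 'm2"
  scen_T :: "real ^ 'n1 ^ 'm2"
  scen_h :: "real ^ 'm2"

(* On real ^ 'n the order is componentwise and 1 is the all-ones vector. *)

definition partition_by :: "'a set \<Rightarrow> 'd set \<Rightarrow> ('d \<Rightarrow> 'a set) \<Rightarrow> bool" where
  "partition_by X D Xs \<longleftrightarrow> disjoint_family_on Xs D \<and> (\<Union>d\<in>D. Xs d) = X"

definition second_stage_rhs ::
    "('n1::finite, 'n2::finite, 'm2::finite) scenario_data \<Rightarrow> real ^ 'n1 \<Rightarrow> real ^ 'm2" where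
  "second_stage_rhs \<xi> x = scen_h \<xi> - scen_T \<xi> *v x"

definition K_scen :: "('n1::finite, 'n2::finite, 'm2::finite) scenario_data \<Rightarrow> (real ^ 'n1) set" where
  "K_scen \<xi> = {x. \<exists>y\<ge>0. scen_W \<xi> *v y = second_stage_rhs \<xi> x}"

definition K_dist ::
    "('d \<Rightarrow> 's set) \<Rightarrow> ('s \<Rightarrow> 'd \<Rightarrow> ('n1::finite, 'n2::finite, 'm2::finite) scenario_data)
      \<Rightarrow> 'd \<Rightarrow> (real ^ 'n1) set" where
  "K_dist S \<xi> d = (\<Inter>s\<in>S d. K_scen (\<xi> s d))"

definition Psi_feasible ::
    "real ^ 'n1 \<Rightarrow> ('n1::finite, 'n2::finite, 'm2::finite) scenario_data
      \<Rightarrow> ((real ^ 'n2) \<times> (real ^ 'm2) \<times> (real ^ 'm2)) set" where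
  "Psi_feasible x \<xi> =
    {(y, wp, wm). 0 \<le> y \<and> 0 \<le> wp \<and> 0 \<le> wm \<and> scen_W \<xi> *v y + wp - wm = second_stage_rhs \<xi> x}"

definition Psi_objective :: "(real ^ 'n2) \<times> (real ^ 'm2) \<times> (real ^ 'm2) \<Rightarrow> real" where
  "Psi_objective = (\<lambda>(y, wp, wm). 1 \<bullet> wp + 1 \<bullet> wm)"

(* The infimum is a minimum: see Psi_attained and Psi_le below. *)
definition Psi ::
    "real ^ 'n1 \<Rightarrow> ('n1::finite, 'n2::finite, 'm2::finite) scenario_data \<Rightarrow> real" where
  "Psi x \<xi> = (INF z\<in>Psi_feasible x \<xi>. Psi_objective z)"

definition Psi_dual_feasible ::
    "('n1::finite, 'n2::finite, 'm2::finite) scenario_data \<Rightarrow> (real ^ 'm2) set" where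
  "Psi_dual_feasible \<xi> = {\<rho>. \<rho> v* scen_W \<xi> \<le> 0 \<and> -1 \<le> \<rho> \<and> \<rho> \<le> 1}"

definition Psi_dual_optimal ::
    "real ^ 'n1 \<Rightarrow> ('n1::finite, 'n2::finite, 'm2::finite) scenario_data \<Rightarrow> real ^ 'm2 \<Rightarrow> bool" where
  "Psi_dual_optimal x \<xi> \<rho> \<longleftrightarrow>
    is_arg_max (\<lambda>\<rho>. \<rho> \<bullet> second_stage_rhs \<xi> x) (\<lambda>\<rho>. \<rho> \<in> Psi_dual_feasible \<xi>) \<rho>"

(* A solution is a feasible point, so the objective c \<bullet> x + \<mu> plays no role. The functions
   are given on the whole space but only evaluated on X. *)
definition RMP_solution ::
    "'a set \<Rightarrow> 'd set \<Rightarrow> ('d \<Rightarrow> 'a set) \<Rightarrow> ('d \<Rightarrow> ('a \<Rightarrow> real) set) \<Rightarrow> ('d \<Rightarrow> ('a \<Rightarrow> real) set)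
      \<Rightarrow> 'a \<Rightarrow> real \<Rightarrow> bool" where
  "RMP_solution X D Xs F Obj x \<mu> \<longleftrightarrow>
    x \<in> X \<and> (\<forall>d\<in>D. x \<in> Xs d \<longrightarrow> (\<forall>f\<in>F d. f x \<le> 0) \<and> (\<forall>g\<in>Obj d. g x \<le> \<mu>))"

lemma Psi_objective_nonneg: "z \<in> Psi_feasible x \<xi> \<Longrightarrow> 0 \<le> Psi_objective z"
  by (auto simp: Psi_feasible_def Psi_objective_def inner_vec_def less_eq_vec_def
      intro!: add_nonneg_nonneg sum_nonneg)

lemma Psi_bdd_below: "bdd_below (Psi_objective ` Psi_feasible x \<xi>)"
  by (rule bdd_belowI2[where m = 0]) (rule Psi_objective_nonneg)

lemma Psi_feasible_nonempty: "Psi_feasible x \<xi> \<noteq> {}"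
proof -
  let ?r = "second_stage_rhs \<xi> x"
  have "(0, (\<chi> i. max 0 (?r $ i)), (\<chi> i. max 0 (- ?r $ i))) \<in> Psi_feasible x \<xi>"
    by (auto simp: Psi_feasible_def less_eq_vec_def vec_eq_iff)
  then show ?thesis by blast
qed

lemma Psi_le: "z \<in> Psi_feasible x \<xi> \<Longrightarrow> Psi x \<xi> \<le> Psi_objective z"
  unfolding Psi_def by (rule cINF_lower[OF Psi_bdd_below])

lemma convex_cone_hull_Basis:
  "convex_cone hull Basis = {z :: 'a::euclidean_space. \<forall>b\<in>Basis. 0 \<le> z \<bullet> b}" (is "?L = ?R")
proof
  have "convex_cone ?R"
    by (auto simp: convex_cone_def convex_def conic_def inner_add_left intro: exI[of _ 0])
  then show "?L \<subseteq> ?R"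
    by (intro hull_minimal) (auto simp: inner_Basis)
  show "?R \<subseteq> ?L"
  proof
    fix z :: 'a assume z: "z \<in> ?R"
    have "(\<Sum>b\<in>B. (z \<bullet> b) *\<^sub>R b) \<in> ?L" if "finite B" "B \<subseteq> Basis" for B
      using that
    proof (induction B rule: finite_induct)
      case empty
      then show ?case by (simp add: convex_cone_hull_contains_0)
    next
      case (insert b B)
      then show ?case
        using z by (simp add: convex_cone_hull_add convex_cone_hull_mul hull_inc subset_iff)
    qed
    from this[of Basis] show "z \<in> ?L" by (simp add: euclidean_representation)
  qed
qed

lemma vec_nonneg_iff_Basis: "(0 :: real ^ 'n) \<le> y \<longleftrightarrow> (\<forall>b\<in>Basis. 0 \<le> y \<bullet> b)"
  by (auto simp: less_eq_vec_def Basis_vec_def inner_axis)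

lemma Psi_attained:
  fixes x :: "real ^ 'n1" and \<xi> :: "('n1::finite, 'n2::finite, 'm2::finite) scenario_data"
  shows "\<exists>z\<in>Psi_feasible x \<xi>. Psi_objective z = Psi x \<xi>"
proof -
  define f :: "(real ^ 'n2) \<times> (real ^ 'm2) \<times> (real ^ 'm2) \<Rightarrow> (real ^ 'm2) \<times> real" where
    "f = (\<lambda>z. (scen_W \<xi> *v fst z + fst (snd z) - snd (snd z), 1 \<bullet> fst (snd z) + 1 \<bullet> snd (snd z)))"
  define C where "C = {z :: (real ^ 'n2) \<times> (real ^ 'm2) \<times> (real ^ 'm2). \<forall>b\<in>Basis. 0 \<le> z \<bullet> b}"
  have C: "z \<in> C \<longleftrightarrow> 0 \<le> fst z \<and> 0 \<le> fst (snd z) \<and> 0 \<le> snd (snd z)" for z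
    by (cases z) (auto simp: C_def Basis_prod_def vec_nonneg_iff_Basis ball_Un)
  have "linear f"
    unfolding f_def
    by (rule linearI) (auto simp: matrix_vector_right_distrib inner_add_right algebra_simps
        matrix_vector_mult_scaleR)
  then have "f ` C = convex_cone hull (f ` Basis)"
    by (simp add: C_def convex_cone_hull_linear_image flip: convex_cone_hull_Basis)
  then have "closed (f ` C)"
    by (simp add: closed_convex_cone_hull)
  then have "closed ((\<lambda>v. (second_stage_rhs \<xi> x, v)) -` (f ` C))"
    by (intro closed_vimage continuous_intros)
  moreover have "Psi_feasible x \<xi> = {z \<in> C. fst (f z) = second_stage_rhs \<xi> x}"
    by (auto simp: f_def C Psi_feasible_def)
  moreover have "Psi_objective z = snd (f z)" for z
    by (simp add: f_def Psi_objective_def split: prod.split)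
  then have "Psi_objective = (\<lambda>z. snd (f z))"
    by blast
  moreover have "(\<lambda>v. (second_stage_rhs \<xi> x, v)) -` (f ` C) =
      (\<lambda>z. snd (f z)) ` {z \<in> C. fst (f z) = second_stage_rhs \<xi> x}"
    unfolding vimage_def image_def prod_eq_iff by force
  ultimately have "closed (Psi_objective ` Psi_feasible x \<xi>)"
    by metis
  then have "Psi x \<xi> \<in> Psi_objective ` Psi_feasible x \<xi>"
    unfolding Psi_def by (intro closed_contains_Inf Psi_bdd_below) (auto simp: Psi_feasible_nonempty)
  then show ?thesis by auto
qed

end

theory Submission
  imports Defs
begin

text \<open>
  The feasible set of the dual of \<Psi> does not depend on the first-stage decision \<open>x\<close>, which only
  enters the dual objective. A dual solution computed at \<open>xv\<close> is therefore dual feasible at \<open>xl\<close>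
  as well, and weak duality bounds the left-hand side of the cut at \<open>xl\<close> by \<open>Psi xl (\<xi> s dv)\<close>.

  If \<open>xl\<close> does not enforce \<open>dv\<close>, the right-hand side is \<open>U dv s\<close>, which dominates this value by the
  choice of \<open>U\<close>. If \<open>xl\<close> does enforce \<open>dv\<close>, the right-hand side is 0; but then \<open>dl = dv\<close> because the
  cells of the partition are disjoint, so the second stage is feasible at \<open>xl\<close> in scenario \<open>s\<close>, no
  slack is needed and \<open>Psi xl (\<xi> s dv)\<close> is not positive.
\<close>

lemma inner_vec_right_mono:
  fixes a b c :: "real ^ 'n"
  assumes "a \<le> b" and "0 \<le> c"
  shows "a \<bullet> c \<le> b \<bullet> c"
  using assms by (auto simp: inner_vec_def less_eq_vec_def intro!: sum_mono mult_right_mono)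

text \<open>
  For a primal feasible \<open>(y, wp, wm)\<close>, the value of \<open>\<rho>\<close> at the right-hand side splits into three terms:
  \<open>\<rho> v* W \<le> 0\<close> makes the \<open>y\<close>-term nonpositive, and the box constraints on \<open>\<rho>\<close> bound the slack
  terms by the objective.
\<close>

lemma Psi_weak_duality:
  assumes "\<rho> \<in> Psi_dual_feasible \<xi>"
  shows "\<rho> \<bullet> second_stage_rhs \<xi> x \<le> Psi x \<xi>"
  unfolding Psi_def
proof (rule cINF_greatest[OF Psi_feasible_nonempty])
  fix z assume "z \<in> Psi_feasible x \<xi>"
  then obtain y wp wm where z: "z = (y, wp, wm)"
    and nonneg: "0 \<le> y" "0 \<le> wp" "0 \<le> wm"
    and eq: "scen_W \<xi> *v y + wp - wm = second_stage_rhs \<xi> x"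
    by (auto simp: Psi_feasible_def)
  have dual: "\<rho> v* scen_W \<xi> \<le> 0" "-1 \<le> \<rho>" "\<rho> \<le> 1"
    using assms by (auto simp: Psi_dual_feasible_def)
  have "\<rho> \<bullet> second_stage_rhs \<xi> x = (\<rho> v* scen_W \<xi>) \<bullet> y + \<rho> \<bullet> wp - \<rho> \<bullet> wm"
    by (simp add: eq[symmetric] inner_add_right inner_diff_right dot_lmul_matrix)
  also have "\<dots> \<le> 1 \<bullet> wp + 1 \<bullet> wm"
    using inner_vec_right_mono[OF dual(1) nonneg(1)] inner_vec_right_mono[OF dual(3) nonneg(2)]
      inner_vec_right_mono[OF dual(2) nonneg(3)]
    by simp
  finally show "\<rho> \<bullet> second_stage_rhs \<xi> x \<le> Psi_objective z"
    by (simp add: z Psi_objective_def)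
qed

text \<open>
  A feasible second-stage decision satisfies the constraints of \<Psi> with both slacks equal to 0.
\<close>

lemma Psi_nonpos_if_K_scen:
  assumes "x \<in> K_scen \<xi>"
  shows "Psi x \<xi> \<le> 0"
proof -
  obtain y where "0 \<le> y" "scen_W \<xi> *v y = second_stage_rhs \<xi> x"
    using assms by (auto simp: K_scen_def)
  then have "(y, 0, 0) \<in> Psi_feasible x \<xi>"
    by (simp add: Psi_feasible_def)
  from Psi_le[OF this] show ?thesis
    by (simp add: Psi_objective_def)
qed

theorem theorem2:
  fixes X :: "(real ^ 'n1) set"
    and D :: "'d set"
    and Xs :: "'d \<Rightarrow> (real ^ 'n1) set"
    and S :: "'d \<Rightarrow> 's set"
    and \<pi> :: "'s \<Rightarrow> 'd \<Rightarrow> real"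
    and \<xi> :: "'s \<Rightarrow> 'd \<Rightarrow> ('n1::finite, 'n2::finite, 'm2::finite) scenario_data"
    and U :: "'d \<Rightarrow> 's \<Rightarrow> real"
    and F Obj :: "'d \<Rightarrow> (real ^ 'n1 \<Rightarrow> real) set"
    and xl xv :: "real ^ 'n1"
    and \<mu>l \<mu>v :: real
    and dl dv :: 'd
    and s :: 's
    and \<rho>v :: "real ^ 'm2"
  assumes "finite D"
    and "partition_by X D Xs"
    and "\<And>d. d \<in> D \<Longrightarrow> finite (S d)"
    and "\<And>d t. d \<in> D \<Longrightarrow> t \<in> S d \<Longrightarrow> \<pi> t d > 0"
    and "\<And>d. d \<in> D \<Longrightarrow> (\<Sum>t\<in>S d. \<pi> t d) = 1"
    and "\<And>d t x. d \<in> D \<Longrightarrow> t \<in> S d \<Longrightarrow> x \<in> X \<Longrightarrow> Psi x (\<xi> t d) \<le> U d t"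
    and "\<And>d. d \<in> D \<Longrightarrow> finite (F d)"
    and "\<And>d. d \<in> D \<Longrightarrow> finite (Obj d)"
    and "RMP_solution X D Xs F Obj xl \<mu>l"
    and "dl \<in> D" and "xl \<in> Xs dl"
    and "xl \<in> K_dist S \<xi> dl"
    and "RMP_solution X D Xs F Obj xv \<mu>v"
    and "dv \<in> D" and "xv \<in> Xs dv"
    and "s \<in> S dv"
    and "Psi_dual_optimal xv (\<xi> s dv) \<rho>v"
  shows "\<rho>v \<bullet> (scen_h (\<xi> s dv) - scen_T (\<xi> s dv) *v xl) \<le> U dv s * (1 - indicator (Xs dv) xl)"
proof -
  have "\<rho>v \<in> Psi_dual_feasible (\<xi> s dv)"
    using assms(17) by (simp add: Psi_dual_optimal_def is_arg_max_def)
  then have cut: "\<rho>v \<bullet> (scen_h (\<xi> s dv) - scen_T (\<xi> s dv) *v xl) \<le> Psi xl (\<xi> s dv)"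
    unfolding second_stage_rhs_def[symmetric] by (rule Psi_weak_duality)
  show ?thesis
  proof (cases "xl \<in> Xs dv")
    case True
    then have "dl = dv"
      using assms(2,10,11,14) by (auto simp: partition_by_def disjoint_family_on_def)
    then have "xl \<in> K_scen (\<xi> s dv)"
      using assms(12,16) by (simp add: K_dist_def)
    from Psi_nonpos_if_K_scen[OF this] cut True show ?thesis
      by simp
  next
    case False
    have "xl \<in> X"
      using assms(9) by (simp add: RMP_solution_def)
    then have "Psi xl (\<xi> s dv) \<le> U dv s"
      using assms(6,14,16) by blast
    with cut False show ?thesis
      by simp
  qed
qed

end
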